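(* Let $R$ be a finite commutative ring with identity with Artin decomposition $R=R_1\times\cdots\times R_s$, where each $R_i$ is a local ring with maximal ideal $\mathfrak{m}_i$ and residue field $R_i/\mathfrak{m}_i\simeq\mathbb{F}_{q_i}$, and let $k\in\mathbb{N}$. If $\gcd(k,|R|)=1$, then $$G_R(k)\simeq\Big(\bigotimes_{i=1}^s\Gamma(k_i,q_i)\Big)\otimes\mathring{K}_m\simeq G_{R_{red}}(k)\otimes\mathring{K}_m\simeq \big(G_{R_{red}}(k)\big)^{(m)},$$ where $k_i=\gcd(k,q_i-1)$ for each $i$ and $m=|\mathcal{N}_R|$.
   Context: For a commutative ring $R$ with identity and a positive integer $k$, $R^*$ is the group of units and $U_{R,k}=\{x^k:x\in R^*\}$. For an abelian group $A$ and $S\subseteq A$ with $0\notin S$, $X(A,S)$ denotes the Cayley digraph with vertex set $A$ and an arc from $v$ to $w$ iff $w-v\in S$. Define $G_R(k)=X(R,U_{R,k})$; for a finite field, the generalized Paley graph is $\Gamma(k,q)=X(\mathbb{F}_q,\{x^k:x\in\mathbb{F}_q^*\})=G_{\mathbb{F}_q}(k)$. $\mathcal{N}_R$ is the nilradical of $R$ and $R_{red}=R/\mathcal{N}_R$ is the reduced ring (here $R_{red}\simeq\mathbb{F}_{q_1}\times\cdots\times\mathbb{F}_{q_s}$). The Kronecker product $\Gamma_1\otimes\cdots\otimes\Gamma_s$ of digraphs (loops allowed) has vertex set $V(\Gamma_1)\times\cdots\times V(\Gamma_s)$, with an arc from $(v_i)$ to $(w_i)$ iff there is an arc from $v_i$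 to $w_i$ in $\Gamma_i$ for every $i$. $\mathring{K}_m$ is the complete graph $K_m$ with a loop attached at each vertex. The balanced blow-up $\Gamma^{(m)}$ is obtained by replacing each vertex $x$ by a set $V_x$ of $m$ independent vertices and each arc from $x$ to $y$ by all arcs from vertices of $V_x$ to vertices of $V_y$. $\simeq$ denotes (di)graph isomorphism. *)

theory Defs
  imports "HOL-Algebra.Algebra" "Graph_Theory.Graph_Theory"
begin

text \<open>
  Digraphs may have loops but no parallel arcs, so they are represented by \<^typ>\<open>'a pair_pre_digraph\<close>;
  their isomorphism is \<^const>\<open>digraph_iso\<close> after the coercion \<^const>\<open>with_proj\<close>.
\<close>

definition cayley_digraph :: "('a, 'n) ring_scheme \<Rightarrow> 'a set \<Rightarrow> 'a pair_pre_digraph"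
  where "cayley_digraph A S =
    \<lparr> pverts = carrier A,
      parcs = {(v, w). v \<in> carrier A \<and> w \<in> carrier A \<and> w \<ominus>\<^bsub>A\<^esub> v \<in> S} \<rparr>"

definition unit_powers :: "('a, 'n) ring_scheme \<Rightarrow> nat \<Rightarrow> 'a set"
  where "unit_powers R k = {x [^]\<^bsub>R\<^esub> k | x. x \<in> Units R}"

definition unit_power_digraph :: "('a, 'n) ring_scheme \<Rightarrow> nat \<Rightarrow> 'a pair_pre_digraph"
  where "unit_power_digraph R k = cayley_digraph R (unit_powers R k)"

text \<open>
  The generalized Paley graph \<open>\<Gamma>(k, q)\<close>, where the field \<open>F\<close> with \<open>q\<close> elements is the first argument.
\<close>

definition generalized_paley :: "('a, 'n) ring_scheme \<Rightarrow> nat \<Rightarrow> 'a pair_pre_digraph"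
  where "generalized_paley F k =
    cayley_digraph F {x [^]\<^bsub>F\<^esub> k | x. x \<in> carrier F - {\<zero>\<^bsub>F\<^esub>}}"

definition nilradical :: "('a, 'n) ring_scheme \<Rightarrow> 'a set"
  where "nilradical R = {x \<in> carrier R. \<exists>n::nat. x [^]\<^bsub>R\<^esub> n = \<zero>\<^bsub>R\<^esub>}"

definition reduced_ring :: "('a, 'n) ring_scheme \<Rightarrow> 'a set ring"
  where "reduced_ring R = R Quot (nilradical R)"

locale local_ring = cring R + maximalideal m R for m and R (structure) +
  assumes unique_maximalideal: "maximalideal J R \<Longrightarrow> J = m"

definition kronecker :: "'a pair_pre_digraph \<Rightarrow> 'b pair_pre_digraph \<Rightarrow> ('a \<times> 'b) pair_pre_digraph"
  where "kronecker G H =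
    \<lparr> pverts = pverts G \<times> pverts H,
      parcs = {((v, x), (w, y)). (v, w) \<in> parcs G \<and> (x, y) \<in> parcs H} \<rparr>"

text \<open>
  Tuples indexed by \<open>I\<close> are extensional functions on \<open>I\<close>; without the first two conjuncts in
  the arc set, values outside \<open>I\<close> would be unconstrained.
\<close>

definition kronecker_prod :: "'i set \<Rightarrow> ('i \<Rightarrow> 'a pair_pre_digraph) \<Rightarrow> ('i \<Rightarrow> 'a) pair_pre_digraph"
  where "kronecker_prod I G =
    \<lparr> pverts = (\<Pi>\<^sub>E i\<in>I. pverts (G i)),
      parcs = {(v, w). v \<in> (\<Pi>\<^sub>E i\<in>I. pverts (G i)) \<and> w \<in> (\<Pi>\<^sub>E i\<in>I. pverts (G i)) \<and>
                       (\<forall>i\<in>I. (v i, w i) \<in> parcs (G i))} \<rparr>"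

definition looped_complete :: "nat \<Rightarrow> nat pair_pre_digraph"
  where "looped_complete m =
    \<lparr> pverts = {..<m},
      parcs = {(u, v). u < m \<and> v < m \<and> u \<noteq> v} \<union> {(v, v) | v. v < m} \<rparr>"

text \<open>
  The class replacing a vertex \<open>x\<close> is \<open>{x} \<times> {..<m}\<close>, which is independent whenever \<open>x\<close> carries no loop.
\<close>

definition balanced_blowup :: "'a pair_pre_digraph \<Rightarrow> nat \<Rightarrow> ('a \<times> nat) pair_pre_digraph"
  where "balanced_blowup G m =
    \<lparr> pverts = pverts G \<times> {..<m},
      parcs = {((x, a), (y, b)). (x, y) \<in> parcs G \<and> a < m \<and> b < m} \<rparr>"

end

theory Submission
  imports Defs
begin

text \<open>
  Write \<open>N\<close> for the nilradical of \<open>R\<close>. The theorem rests on one arithmetic fact: the set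
  \<open>U\<close> of \<open>k\<close>-th powers of units is a union of cosets of \<open>N\<close>. Indeed, for \<open>u\<close> a unit and
  \<open>n \<in> N\<close> one has \<open>u\<^sup>k + n = u\<^sup>k (1 + u\<^sup>-\<^sup>k n)\<close>, and \<open>1 + N\<close> is a group of units whose order
  \<open>|N|\<close> divides \<open>|R|\<close>, hence is coprime to \<open>k\<close>; so the second factor is itself a \<open>k\<close>-th power.
  Whether \<open>y - x\<close> lies in \<open>U\<close> therefore depends only on the classes of \<open>x\<close> and \<open>y\<close> modulo \<open>N\<close>,
  and numbering the elements of each class from \<open>0\<close> to \<open>|N| - 1\<close> splits off a factor that is
  complete with loops (\<open>digraph_iso_kronecker_looped_complete\<close>).

  The two descriptions of the other factor come from two ways to present \<open>R / N\<close>: as the quotient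
  ring itself, and as the product of the residue fields of the local factors, since the maximal
  ideal of a finite local ring is nil (\<open>finite_maximalideal_nilpotent\<close>). The locale
  \<open>nilradical_kernel_family\<close> treats both at once: it is about a family of ring homomorphisms out of
  \<open>R\<close> that is jointly surjective with joint kernel \<open>N\<close>, and its main result \<open>unit_powers_iff\<close> says that
  being a \<open>k\<close>-th power of a unit can be tested in the family. In a field with \<open>q\<close> elements the
  nonzero \<open>k\<close>-th powers are the nonzero \<open>gcd(k, q - 1)\<close>-th powers, because the group of units has
  order \<open>q - 1\<close>; this turns the factors into generalized Paley graphs. Finally, a blow-up is by
  definition a Kronecker product with a complete graph with loops.
\<close>

(* The symbol denotes ring addition below, not the concatenation of walks. *)
no_notation vwalk_join (infixr "\<oplus>" 65)

section \<open>Isomorphisms of digraphs\<close>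

lemma digraph_isoI:
  assumes "bij_betw \<phi> (pverts G) (pverts H)"
    and "parcs G \<subseteq> pverts G \<times> pverts G" and "parcs H \<subseteq> pverts H \<times> pverts H"
    and "\<And>x y. x \<in> pverts G \<Longrightarrow> y \<in> pverts G \<Longrightarrow> (x, y) \<in> parcs G \<longleftrightarrow> (\<phi> x, \<phi> y) \<in> parcs H"
  shows "digraph_iso (with_proj G) (with_proj H)"
proof -
  define hom where "hom = \<lparr>iso_verts = \<phi>, iso_arcs = map_prod \<phi> \<phi>, iso_head = snd, iso_tail = fst\<rparr>"
  have inj: "inj_on \<phi> (pverts G)" and img: "\<phi> ` pverts G = pverts H"
    using assms(1) by (auto simp: bij_betw_def)
  have "wf_digraph (with_proj G)"
    using assms(2) by unfold_locales auto
  moreover have "inj_on (map_prod \<phi> \<phi>) (parcs G)"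
    by (rule inj_on_subset[OF map_prod_inj_on[OF inj inj] assms(2)])
  ultimately have "pre_digraph.digraph_isomorphism (with_proj G) hom"
    using inj by (auto simp: pre_digraph.digraph_isomorphism_def hom_def)
  moreover have "map_prod \<phi> \<phi> ` parcs G = parcs H"
  proof
    show "map_prod \<phi> \<phi> ` parcs G \<subseteq> parcs H"
      using assms(2,4) by auto
    show "parcs H \<subseteq> map_prod \<phi> \<phi> ` parcs G"
    proof
      fix e assume e: "e \<in> parcs H"
      then obtain x y where "x \<in> pverts G" "y \<in> pverts G" "e = (\<phi> x, \<phi> y)"
        using assms(3) img by (cases e) blast
      with e assms(4)[of x y] show "e \<in> map_prod \<phi> \<phi> ` parcs G"
        by (auto intro!: image_eqI[of _ _ "(x, y)"])
    qed
  qed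
  then have "with_proj H = app_iso hom (with_proj G)"
    using img by (simp add: app_iso_def hom_def with_proj_def)
  ultimately show ?thesis
    unfolding digraph_iso_def by blast
qed

text \<open>
  A factor \<open>looped_complete m\<close> puts no condition on arcs, so a bijection from each fibre to
  \<open>{..<m}\<close> supplies the second coordinate of the isomorphism and \<open>f\<close> the first.
\<close>

lemma digraph_iso_kronecker_looped_complete:
  assumes fin: "finite (pverts G)"
    and surj: "f ` pverts G = pverts H"
    and fibres: "\<And>y. y \<in> pverts H \<Longrightarrow> card {x \<in> pverts G. f x = y} = m"
    and "parcs G \<subseteq> pverts G \<times> pverts G" and "parcs H \<subseteq> pverts H \<times> pverts H"
    and arcs: "\<And>x y. x \<in> pverts G \<Longrightarrow> y \<in> pverts G \<Longrightarrow> (x, y) \<in> parcs G \<longleftrightarrow> (f x, f y) \<in> parcs H"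
  shows "digraph_iso (with_proj G) (with_proj (kronecker H (looped_complete m)))"
proof -
  define fibre where "fibre y = {x \<in> pverts G. f x = y}" for y
  have "\<forall>y \<in> pverts H. \<exists>g. bij_betw g (fibre y) {..<m}"
  proof
    fix y assume "y \<in> pverts H"
    then have "card (fibre y) = m" unfolding fibre_def by (rule fibres)
    moreover have "finite (fibre y)" using fin by (simp add: fibre_def)
    ultimately show "\<exists>g. bij_betw g (fibre y) {..<m}"
      using ex_bij_betw_finite_nat[of "fibre y"] by (simp add: atLeast0LessThan)
  qed
  from bchoice[OF this] obtain g where g: "\<And>y. y \<in> pverts H \<Longrightarrow> bij_betw (g y) {x \<in> pverts G. f x = y} {..<m}"
    unfolding fibre_def by blast
  define \<phi> where "\<phi> x = (f x, g (f x) x)" for x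
  have mem: "f x \<in> pverts H" "g (f x) x < m" if "x \<in> pverts G" for x
    using that surj g[of "f x"] by (auto simp: bij_betw_def)
  have "bij_betw \<phi> (pverts G) (pverts H \<times> {..<m})"
    unfolding bij_betw_def
  proof
    show "inj_on \<phi> (pverts G)"
    proof (rule inj_onI)
      fix x y assume xy: "x \<in> pverts G" "y \<in> pverts G" "\<phi> x = \<phi> y"
      then have "f x = f y" "g (f x) x = g (f x) y" by (auto simp: \<phi>_def)
      with xy g[OF mem(1)[OF xy(1)]] show "x = y"
        by (auto simp: bij_betw_def inj_on_def)
    qed
    show "\<phi> ` pverts G = pverts H \<times> {..<m}"
    proof
      show "\<phi> ` pverts G \<subseteq> pverts H \<times> {..<m}" using mem by (auto simp: \<phi>_def)
      show "pverts H \<times> {..<m} \<subseteq> \<phi> ` pverts G"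
      proof clarify
        fix y b assume "y \<in> pverts H" "b < m"
        then have "b \<in> g y ` {x \<in> pverts G. f x = y}"
          using g[of y] by (auto simp: bij_betw_def)
        then show "(y, b) \<in> \<phi> ` pverts G" by (auto simp: \<phi>_def)
      qed
    qed
  qed
  then show ?thesis
    using assms(4,5) arcs mem
    by (intro digraph_isoI[of \<phi>]) (auto simp: kronecker_def looped_complete_def \<phi>_def)
qed

lemma kronecker_prod_cong:
  assumes "\<And>i. i \<in> I \<Longrightarrow> G i = H i"
  shows "kronecker_prod I G = kronecker_prod I H"
proof -
  have "(\<Pi>\<^sub>E i\<in>I. pverts (G i)) = (\<Pi>\<^sub>E i\<in>I. pverts (H i))"
    using assms by (intro PiE_cong) simp
  then show ?thesis
    unfolding kronecker_prod_def using assms by simp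
qed

lemma balanced_blowup_eq_kronecker_looped_complete:
  "balanced_blowup G m = kronecker G (looped_complete m)"
  by (auto simp: balanced_blowup_def kronecker_def looped_complete_def)

section \<open>Powers in finite groups and fields\<close>

text \<open>
  Bezout: \<open>gcd k |G|\<close> is a multiple of \<open>k\<close> modulo \<open>|G|\<close>, and exponents only matter modulo \<open>|G|\<close>.
  With \<open>k\<close> coprime to \<open>|G|\<close> this makes every element a \<open>k\<close>-th power.
\<close>

lemma (in group) pow_eq_pow_gcd_order:
  assumes "finite (carrier G)" and "k > 0" and "x \<in> carrier G"
  shows "\<exists>y \<in> carrier G. y [^] k = x [^] gcd k (order G)"
proof -
  obtain a b where ab: "k * a = order G * b + gcd k (order G)"
    using bezout_nat[of k "order G"] assms(2) by auto
  have "(x [^] a) [^] k = x [^] (order G * b + gcd k (order G))"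
    using assms(3) ab by (simp add: nat_pow_pow mult.commute)
  also have "\<dots> = x [^] gcd k (order G)"
    using assms(1,3) pow_order_eq_1 by (simp flip: nat_pow_mult nat_pow_pow)
  finally show ?thesis using assms(3) by (intro bexI[of _ "x [^] a"]) auto
qed

lemma unit_powers_gcd_field:
  assumes "field F" and "finite (carrier F)" and "k > 0"
  shows "{x [^]\<^bsub>F\<^esub> gcd k (card (carrier F) - 1) | x. x \<in> carrier F - {\<zero>\<^bsub>F\<^esub>}} = unit_powers F k"
proof -
  interpret F: field F by fact
  let ?n = "card (carrier F) - 1"
  interpret U: group "units_of F" by (rule F.units_group)
  have un: "Units F = carrier F - {\<zero>\<^bsub>F\<^esub>}" by (rule F.field_Units)
  have ord: "order (units_of F) = ?n"
    using assms(2) by (simp add: order_def units_of_carrier un)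
  show ?thesis
    unfolding unit_powers_def un[symmetric]
  proof (intro equalityI subsetI; clarify)
    fix x assume x: "x \<in> Units F"
    then obtain y where "y \<in> Units F" "y [^]\<^bsub>units_of F\<^esub> k = x [^]\<^bsub>units_of F\<^esub> gcd k ?n"
      using U.pow_eq_pow_gcd_order[of k x] assms(2,3) ord un by (auto simp: units_of_carrier)
    then show "\<exists>y. x [^]\<^bsub>F\<^esub> gcd k ?n = y [^]\<^bsub>F\<^esub> k \<and> y \<in> Units F"
      using x by (metis F.units_of_pow)
  next
    fix x assume x: "x \<in> Units F"
    obtain d where d: "k = d * gcd k ?n" by (metis dvd_div_mult_self gcd_dvd1)
    have "x [^]\<^bsub>F\<^esub> k = (x [^]\<^bsub>F\<^esub> d) [^]\<^bsub>F\<^esub> gcd k ?n"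
      using x d by (simp add: F.nat_pow_pow F.Units_closed)
    then show "\<exists>y. x [^]\<^bsub>F\<^esub> k = y [^]\<^bsub>F\<^esub> gcd k ?n \<and> y \<in> Units F"
      using x F.Units_pow_closed by blast
  qed
qed

section \<open>Nilpotent elements\<close>

text \<open>
  Instead of summing a geometric series, the induction squares \<open>x\<close>: \<open>1 - x\<close> divides
  \<open>1 - x\<^sup>2\<close>, and \<open>x\<^sup>2\<close> vanishes already at the power \<open>n - 1\<close> once \<open>n \<ge> 2\<close>.
\<close>

lemma (in cring) one_minus_nilpotent_Unit:
  fixes n :: nat
  assumes "x \<in> carrier R" and "x [^] n = \<zero>"
  shows "\<one> \<ominus> x \<in> Units R"
  using assms
proof (induction n arbitrary: x rule: less_induct)
  case (less n)
  show ?case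
  proof (cases "n \<le> 1")
    case True
    then have "x = \<zero>"
      using less.prems one_zeroD by (cases n) auto
    then show ?thesis by (simp add: minus_eq)
  next
    case False
    have "(x \<otimes> x) [^] (n - 1) = x [^] (n + (n - 2))"
      using less.prems(1) False
      by (simp add: nat_pow_distrib nat_pow_mult numeral_2_eq_2)
    also have "\<dots> = \<zero>"
      using less.prems by (simp flip: nat_pow_mult)
    finally have "\<one> \<ominus> x \<otimes> x \<in> Units R"
      using less.IH[of "n - 1" "x \<otimes> x"] less.prems(1) False by simp
    moreover have "\<one> \<ominus> x \<otimes> x = (\<one> \<ominus> x) \<otimes> (\<one> \<oplus> x)"
      using less.prems(1) by algebra
    ultimately show ?thesis
      using unit_factor[of "\<one> \<ominus> x" "\<one> \<oplus> x"] less.prems(1) by simp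
  qed
qed

text \<open>
  A nonunit generates a proper ideal. Among the finitely many proper ideals containing it
  one is maximal, and by locality this is \<open>m\<close>.
\<close>

lemma (in local_ring) finite_maximalideal_complement_Units:
  assumes "finite (carrier R)" and "x \<in> carrier R" and "x \<notin> m"
  shows "x \<in> Units R"
proof (rule ccontr)
  assume nu: "x \<notin> Units R"
  let ?A = "{J. ideal J R \<and> J \<noteq> carrier R}"
  have "ideal (PIdl x) R" using assms(2) by (rule cgenideal_ideal)
  moreover have "\<one> \<notin> PIdl x"
    using nu assms(2) m_comm by (force simp: cgenideal_def Units_def)
  ultimately have x: "PIdl x \<in> ?A" by auto
  have "?A \<subseteq> Pow (carrier R)"
    using additive_subgroup.a_subset ideal.axioms(1) by blast
  then have "finite ?A" using assms(1) finite_subset by blast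
  from finite_has_maximal2[OF this x]
  obtain J where J: "J \<in> ?A" "PIdl x \<subseteq> J" and max: "\<forall>b \<in> ?A. J \<subseteq> b \<longrightarrow> J = b" by auto
  have "maximalideal J R"
    using J max by (intro maximalidealI) auto
  then have "J = m" by (rule unique_maximalideal)
  moreover have "x \<in> PIdl x" using assms(2) by (rule cgenideal_self)
  ultimately show False using J(2) assms(3) by auto
qed

lemma finite_monoid_pow_cycle:
  assumes "monoid G" and "finite (carrier G)" and "x \<in> carrier G"
  obtains a b :: nat where "b > 0" and "x [^]\<^bsub>G\<^esub> (a + b) = x [^]\<^bsub>G\<^esub> a"
proof -
  interpret monoid G by fact
  have "finite (range (\<lambda>n::nat. x [^]\<^bsub>G\<^esub> n))"
    using assms(2,3) by (auto intro: finite_subset)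
  then have "\<not> inj (\<lambda>n::nat. x [^]\<^bsub>G\<^esub> n)"
    using finite_imageD infinite_UNIV_nat by blast
  then obtain c d :: nat where "c < d" "x [^]\<^bsub>G\<^esub> c = x [^]\<^bsub>G\<^esub> d"
    unfolding inj_on_def by (metis linorder_neqE_nat)
  then show thesis using that[of "d - c" c] by simp
qed

text \<open>
  The powers of \<open>x\<close> must repeat, so \<open>x\<^sup>a (1 - x\<^sup>b) = 0\<close> for some \<open>b > 0\<close>; the second factor is a
  unit because it is congruent to \<open>1\<close> modulo \<open>m\<close>.
\<close>

lemma (in local_ring) finite_maximalideal_nilpotent:
  assumes "finite (carrier R)" and "x \<in> m"
  shows "\<exists>n::nat. x [^] n = \<zero>"
proof -
  have x: "x \<in> carrier R" using assms(2) by (rule Icarr)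
  obtain a b :: nat where b: "b > 0" and ab: "x [^] (a + b) = x [^] a"
    using finite_monoid_pow_cycle[OF monoid_axioms assms(1) x] by blast
  have "x [^] (Suc (b - 1)) \<in> m"
    using x assms(2) by (simp add: I_l_closed)
  then have xb: "x [^] b \<in> m" using b by simp
  have "\<one> \<ominus> x [^] b \<notin> m"
  proof
    assume "\<one> \<ominus> x [^] b \<in> m"
    then have "(\<one> \<ominus> x [^] b) \<oplus> x [^] b \<in> m" using xb by simp
    moreover have "(\<one> \<ominus> x [^] b) \<oplus> x [^] b = \<one>"
      using x by (simp add: minus_eq a_assoc l_neg)
    ultimately show False using one_imp_carrier I_notcarr by simp
  qed
  then have u: "\<one> \<ominus> x [^] b \<in> Units R"
    using finite_maximalideal_complement_Units[OF assms(1)] x by simp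
  have "(\<one> \<ominus> x [^] b) \<otimes> x [^] a = x [^] a \<ominus> x [^] (a + b)"
    using x by (simp add: minus_eq l_distr r_distr l_minus r_minus m_comm flip: nat_pow_mult)
  also have "\<dots> = (\<one> \<ominus> x [^] b) \<otimes> \<zero>" using x ab by (simp add: r_neg minus_eq)
  finally have "x [^] a = \<zero>"
    using u x by (subst (asm) Units_l_cancel) auto
  then show ?thesis ..
qed

section \<open>Homomorphisms with joint kernel the nilradical\<close>

lemma nth_RDirProd_list_ring_hom:
  assumes "i < length Rs"
  shows "(\<lambda>xs. xs ! i) \<in> ring_hom (RDirProd_list Rs) (Rs ! i)"
  using assms
proof (induction Rs arbitrary: i)
  case (Cons R Rs)
  let ?g = "\<lambda>(a, as). a # as"
  let ?P = "RDirProd_list Rs"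
  have hom: "?g \<in> ring_hom (RDirProd R ?P) (RDirProd_list (R # Rs))"
    by (rule RDirProd_list_hom1)
  have mult: "(x # xs) \<otimes>\<^bsub>RDirProd_list (R # Rs)\<^esub> (y # ys) = (x \<otimes>\<^bsub>R\<^esub> y) # (xs \<otimes>\<^bsub>?P\<^esub> ys)"
    and add: "(x # xs) \<oplus>\<^bsub>RDirProd_list (R # Rs)\<^esub> (y # ys) = (x \<oplus>\<^bsub>R\<^esub> y) # (xs \<oplus>\<^bsub>?P\<^esub> ys)"
    if "x \<in> carrier R" "y \<in> carrier R" "xs \<in> carrier ?P" "ys \<in> carrier ?P" for x y xs ys
    using ring_hom_mult[OF hom, of "(x, xs)" "(y, ys)"] ring_hom_add[OF hom, of "(x, xs)" "(y, ys)"] that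
    by (simp_all add: RDirProd_carrier) (simp_all add: RDirProd_def DirProd_def monoid.defs)
  have one: "\<one>\<^bsub>RDirProd_list (R # Rs)\<^esub> = \<one>\<^bsub>R\<^esub> # \<one>\<^bsub>?P\<^esub>"
    by (simp add: RDirProd_list_one)
  show ?case
  proof (cases i)
    case 0
    then show ?thesis
      by (auto intro!: ring_hom_memI simp: RDirProd_list_carrier mult add one)
  next
    case (Suc j)
    then have hom_j: "(\<lambda>xs. xs ! j) \<in> ring_hom ?P (Rs ! j)" using Cons by simp
    show ?thesis
      unfolding Suc
      using ring_hom_closed[OF hom_j] ring_hom_mult[OF hom_j] ring_hom_add[OF hom_j] ring_hom_one[OF hom_j]
      by (auto intro!: ring_hom_memI simp: RDirProd_list_carrier mult add one)
  qed
qed simp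

lemma ring_hom_nat_pow:
  assumes "ring R" and "ring S" and "h \<in> ring_hom R S" and "x \<in> carrier R"
  shows "h (x [^]\<^bsub>R\<^esub> (n::nat)) = h x [^]\<^bsub>S\<^esub> n"
proof -
  interpret ring_hom_ring R S h
    using assms by (intro ring_hom_ringI2)
  show ?thesis using assms(4) by (rule hom_nat_pow)
qed

text \<open>
  In other words, the family induces an isomorphism from \<open>R / N\<close> to the product of the rings \<open>S i\<close>.
  The product is not formed as a ring: the digraph on it is a Kronecker product, which refers
  to the coordinates anyway.
\<close>

locale nilradical_kernel_family = cring R for R (structure) +
  fixes I :: "'i set"
    and S :: "'i \<Rightarrow> ('c, 'l) ring_scheme"
    and f :: "'i \<Rightarrow> 'a \<Rightarrow> 'c"
  assumes finite_carrier: "finite (carrier R)"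
    and ring_S: "i \<in> I \<Longrightarrow> ring (S i)"
    and hom_f: "i \<in> I \<Longrightarrow> f i \<in> ring_hom R (S i)"
    and jointly_surj: "(\<And>i. i \<in> I \<Longrightarrow> y i \<in> carrier (S i)) \<Longrightarrow> \<exists>x \<in> carrier R. \<forall>i \<in> I. f i x = y i"
    and joint_kernel: "{x \<in> carrier R. \<forall>i \<in> I. f i x = \<zero>\<^bsub>S i\<^esub>} = nilradical R"
begin

lemma ring_hom_ring_f: "i \<in> I \<Longrightarrow> ring_hom_ring R (S i) (f i)"
  by (rule ring_hom_ringI2[OF ring_axioms ring_S hom_f])

lemma f_closed: "i \<in> I \<Longrightarrow> x \<in> carrier R \<Longrightarrow> f i x \<in> carrier (S i)"
  by (rule ring_hom_closed[OF hom_f])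

lemma f_minus:
  assumes "i \<in> I" and "x \<in> carrier R" and "y \<in> carrier R"
  shows "f i (x \<ominus> y) = f i x \<ominus>\<^bsub>S i\<^esub> f i y"
proof -
  interpret ring_hom_ring R "S i" "f i" using assms(1) by (rule ring_hom_ring_f)
  show ?thesis using assms by (simp add: a_minus_def)
qed

lemma minus_in_nilradical_iff:
  assumes "x \<in> carrier R" and "y \<in> carrier R"
  shows "x \<ominus> y \<in> nilradical R \<longleftrightarrow> (\<forall>i \<in> I. f i x = f i y)"
proof -
  have "f i (x \<ominus> y) = \<zero>\<^bsub>S i\<^esub> \<longleftrightarrow> f i x = f i y" if "i \<in> I" for i
  proof -
    interpret S: ring "S i" using that by (rule ring_S)
    show ?thesis using assms that by (simp add: f_minus f_closed)
  qed
  then show ?thesis using assms by (simp flip: joint_kernel)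
qed

lemma nilradical_ideal: "ideal (nilradical R) R"
proof -
  have "nilradical R = carrier R \<inter> (\<Inter>i\<in>I. a_kernel R (S i) (f i))"
    unfolding joint_kernel[symmetric] by (auto simp: a_kernel_def')
  moreover have "ideal (a_kernel R (S i) (f i)) R" if "i \<in> I" for i
    using ring_hom_ring_f[OF that] by (rule ring_hom_ring.kernel_is_ideal)
  ultimately show ?thesis
    using i_Intersect[of "insert (carrier R) ((\<lambda>i. a_kernel R (S i) (f i)) ` I)"] oneideal by auto
qed

lemma card_nilradical_dvd: "card (nilradical R) dvd card (carrier R)"
proof -
  interpret ideal "nilradical R" R by (rule nilradical_ideal)
  show ?thesis
    using add.lagrange[OF a_subgroup] by (simp add: order_def) (metis dvd_triv_right)
qed

lemma one_plus_in_units: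
  assumes "n \<in> nilradical R"
  shows "\<one> \<oplus> n \<in> Units R"
proof -
  have n: "n \<in> carrier R"
    using assms by (simp add: nilradical_def)
  interpret ideal "nilradical R" R by (rule nilradical_ideal)
  have "\<ominus> n \<in> nilradical R" using assms by simp
  then obtain e :: nat where "(\<ominus> n) [^] e = \<zero>"
    unfolding nilradical_def by blast
  then have "\<one> \<ominus> (\<ominus> n) \<in> Units R"
    using n one_minus_nilpotent_Unit by blast
  then show ?thesis using n by (simp add: a_minus_def)
qed

text \<open>This description makes the closure properties of \<open>1 + N\<close> evident.\<close>

lemma one_plus_nilradical_eq:
  "(\<oplus>) \<one> ` nilradical R = {x \<in> carrier R. \<forall>i \<in> I. f i x = \<one>\<^bsub>S i\<^esub>}"
proof -
  interpret ideal "nilradical R" R by (rule nilradical_ideal)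
  have one: "f i \<one> = \<one>\<^bsub>S i\<^esub>" if "i \<in> I" for i
    using hom_f[OF that] by (rule ring_hom_one)
  have "x \<in> (\<oplus>) \<one> ` nilradical R \<longleftrightarrow> x \<ominus> \<one> \<in> nilradical R" if "x \<in> carrier R" for x
  proof
    assume "x \<ominus> \<one> \<in> nilradical R"
    moreover have "x = \<one> \<oplus> (x \<ominus> \<one>)" using that by algebra
    ultimately show "x \<in> (\<oplus>) \<one> ` nilradical R" by blast
  next
    assume "x \<in> (\<oplus>) \<one> ` nilradical R"
    then obtain n where "n \<in> nilradical R" "x = \<one> \<oplus> n" by auto
    moreover from this have "x \<ominus> \<one> = n" using Icarr[of n] by algebra
    ultimately show "x \<ominus> \<one> \<in> nilradical R" by simp
  qed
  then have iff: "x \<in> (\<oplus>) \<one> ` nilradical R \<longleftrightarrow> (\<forall>i \<in> I. f i x = \<one>\<^bsub>S i\<^esub>)" if "x \<in> carrier R" for x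
    using that minus_in_nilradical_iff[of x \<one>] one by simp
  have sub: "(\<oplus>) \<one> ` nilradical R \<subseteq> carrier R" using Icarr by auto
  have "A = {x \<in> carrier R. P x}"
    if "\<And>x. x \<in> carrier R \<Longrightarrow> x \<in> A \<longleftrightarrow> P x" "A \<subseteq> carrier R" for A P
    using that by blast
  from this[OF iff sub] show ?thesis .
qed

lemma one_plus_nilradical_subgroup:
  "subgroup ((\<oplus>) \<one> ` nilradical R) (units_of R)"
proof -
  interpret U: group "units_of R" by (rule units_group)
  let ?H = "(\<oplus>) \<one> ` nilradical R"
  have un: "x \<in> Units R" if "x \<in> ?H" for x using that one_plus_in_units by auto
  have one: "\<one> \<in> ?H"
    unfolding one_plus_nilradical_eq using ring_hom_one[OF hom_f] by auto
  have mult: "x \<otimes> y \<in> ?H" if "x \<in> ?H" "y \<in> ?H" for x y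
    using that ring_S[THEN ring.is_monoid] unfolding one_plus_nilradical_eq
    by (auto simp: ring_hom_mult[OF hom_f])
  have inv: "inv x \<in> ?H" if x: "x \<in> ?H" for x
  proof -
    have "f i (inv x) = \<one>\<^bsub>S i\<^esub>" if i: "i \<in> I" for i
    proof -
      interpret S: ring "S i" using i by (rule ring_S)
      have "f i (inv x) = f i x \<otimes>\<^bsub>S i\<^esub> f i (inv x)"
        using x i un[OF x] f_closed[OF i] unfolding one_plus_nilradical_eq by auto
      also have "\<dots> = f i (x \<otimes> inv x)"
        using un[OF x] by (intro ring_hom_mult[OF hom_f[OF i], symmetric]) auto
      also have "\<dots> = \<one>\<^bsub>S i\<^esub>"
        using un[OF x] ring_hom_one[OF hom_f[OF i]] by simp
      finally show ?thesis .
    qed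
    then show ?thesis using un[OF x] unfolding one_plus_nilradical_eq by auto
  qed
  show ?thesis
    using un one mult inv
    by (intro U.subgroupI) (auto simp: units_of_carrier units_of_mult units_of_inv)
qed

text \<open>
  The only use of coprimality: the order \<open>|N|\<close> of the group \<open>1 + N\<close> divides \<open>|R|\<close>.
\<close>

lemma one_plus_nilradical_power:
  assumes "k > 0" and "gcd k (card (carrier R)) = 1" and "n \<in> nilradical R"
  shows "\<exists>u \<in> Units R. u [^] k = \<one> \<oplus> n"
proof -
  let ?H = "(\<oplus>) \<one> ` nilradical R"
  let ?U = "(units_of R)\<lparr>carrier := ?H\<rparr>"
  interpret U: group "units_of R" by (rule units_group)
  interpret H: group ?U
    using one_plus_nilradical_subgroup units_group by (rule subgroup.subgroup_is_group)
  interpret ideal "nilradical R" R by (rule nilradical_ideal)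
  have fin: "finite (carrier ?U)"
    using finite_subset[OF a_subset finite_carrier] by simp
  have "inj_on ((\<oplus>) \<one>) (nilradical R)"
    using Icarr by (auto simp: inj_on_def)
  then have "order ?U = card (nilradical R)" by (simp add: order_def card_image)
  then have gcd: "gcd k (order ?U) = 1"
    using assms(2) card_nilradical_dvd by (metis coprime_iff_gcd_eq_1 coprime_divisors dvd_refl)
  have n: "\<one> \<oplus> n \<in> carrier ?U" using assms(3) by simp
  obtain u where u: "u \<in> ?H" "u [^]\<^bsub>?U\<^esub> k = \<one> \<oplus> n"
    using H.pow_eq_pow_gcd_order[OF fin assms(1) n, unfolded gcd H.nat_pow_eone[OF n]] by auto
  have "u \<in> Units R" using u(1) one_plus_in_units by auto
  moreover have "u [^] k = \<one> \<oplus> n"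
    using u(2) units_of_pow[OF \<open>u \<in> Units R\<close>, of k] U.nat_pow_consistent[of u k ?H] by simp
  ultimately show ?thesis by blast
qed

text \<open>
  Units lift: if \<open>y\<close> is mapped to the inverses of the images of \<open>x\<close>, then \<open>x y \<in> 1 + N\<close> is a unit,
  and so is its factor \<open>x\<close>.
\<close>

lemma Units_iff:
  assumes "x \<in> carrier R"
  shows "x \<in> Units R \<longleftrightarrow> (\<forall>i \<in> I. f i x \<in> Units (S i))"
proof
  assume x: "x \<in> Units R"
  show "\<forall>i \<in> I. f i x \<in> Units (S i)"
  proof
    fix i assume i: "i \<in> I"
    have "f i x \<otimes>\<^bsub>S i\<^esub> f i (inv x) = \<one>\<^bsub>S i\<^esub>" "f i (inv x) \<otimes>\<^bsub>S i\<^esub> f i x = \<one>\<^bsub>S i\<^esub>"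
      using x ring_hom_one[OF hom_f[OF i]]
      by (simp_all flip: ring_hom_mult[OF hom_f[OF i]] add: Units_closed)
    then show "f i x \<in> Units (S i)"
      using x f_closed[OF i] by (auto simp: Units_def[of "S i"])
  qed
next
  assume u: "\<forall>i \<in> I. f i x \<in> Units (S i)"
  obtain y where y: "y \<in> carrier R" "\<forall>i \<in> I. f i y = inv\<^bsub>S i\<^esub> f i x"
    using jointly_surj[of "\<lambda>i. inv\<^bsub>S i\<^esub> f i x"] u ring_S by (meson monoid.Units_inv_closed ring.is_monoid)
  have "f i (x \<otimes> y) = \<one>\<^bsub>S i\<^esub>" if "i \<in> I" for i
    using that y u assms ring_S[THEN ring.is_monoid]
    by (simp add: ring_hom_mult[OF hom_f] monoid.Units_r_inv)
  then have "x \<otimes> y \<in> (\<oplus>) \<one> ` nilradical R"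
    unfolding one_plus_nilradical_eq using assms y(1) by auto
  then have "x \<otimes> y \<in> Units R" using one_plus_in_units by auto
  then show "x \<in> Units R" using unit_factor assms y(1) by blast
qed

text \<open>
  Roots chosen in the rings \<open>S i\<close> lift to one unit \<open>u\<close> of \<open>R\<close>, whose \<open>k\<close>-th power differs from
  \<open>z\<close> by an element of \<open>N\<close>; a \<open>k\<close>-th root \<open>w\<close> of \<open>1 + u\<^sup>-\<^sup>k (z - u\<^sup>k)\<close> corrects the difference.
\<close>

lemma unit_powers_iff:
  assumes "k > 0" and "gcd k (card (carrier R)) = 1" and z: "z \<in> carrier R"
  shows "z \<in> unit_powers R k \<longleftrightarrow> (\<forall>i \<in> I. f i z \<in> unit_powers (S i) k)"
proof
  assume "z \<in> unit_powers R k"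
  then obtain u where u: "u \<in> Units R" "z = u [^] k" by (auto simp: unit_powers_def)
  show "\<forall>i \<in> I. f i z \<in> unit_powers (S i) k"
  proof
    fix i assume i: "i \<in> I"
    have "u \<in> carrier R" using u(1) by (rule Units_closed)
    then have "f i z = f i u [^]\<^bsub>S i\<^esub> k"
      using ring_hom_ring.hom_nat_pow[OF ring_hom_ring_f[OF i]] u(2) by simp
    moreover have "f i u \<in> Units (S i)" using u i Units_iff[of u] by blast
    ultimately show "f i z \<in> unit_powers (S i) k" by (auto simp: unit_powers_def)
  qed
next
  assume "\<forall>i \<in> I. f i z \<in> unit_powers (S i) k"
  then obtain v where v: "\<And>i. i \<in> I \<Longrightarrow> v i \<in> Units (S i)" "\<And>i. i \<in> I \<Longrightarrow> f i z = v i [^]\<^bsub>S i\<^esub> k"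
    unfolding unit_powers_def by (simp add: Bex_def) metis
  obtain u where u: "u \<in> carrier R" "\<forall>i \<in> I. f i u = v i"
    using jointly_surj[of v] v(1) by (auto simp: Units_def)
  have uU: "u \<in> Units R" using Units_iff[of u] u v(1) by simp
  have "z \<ominus> u [^] k \<in> nilradical R"
  proof -
    have "f i z = f i (u [^] k)" if i: "i \<in> I" for i
    proof -
      interpret ring_hom_ring R "S i" "f i" using i by (rule ring_hom_ring_f)
      show ?thesis using i u v by (simp add: hom_nat_pow)
    qed
    then show ?thesis using z u by (simp add: minus_in_nilradical_iff)
  qed
  then have "inv u [^] k \<otimes> (z \<ominus> u [^] k) \<in> nilradical R" (is "?n \<in> _")
    using uU by (simp add: ideal.I_l_closed[OF nilradical_ideal])
  from one_plus_nilradical_power[OF assms(1,2) this]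
  obtain w where w: "w \<in> Units R" "w [^] k = \<one> \<oplus> ?n" by blast
  have inv: "u [^] k \<otimes> inv u [^] k = \<one>"
    using uU by (simp add: Units_closed flip: nat_pow_distrib)
  have "(u \<otimes> w) [^] k = u [^] k \<otimes> (\<one> \<oplus> ?n)"
    using w u by (simp add: nat_pow_distrib Units_closed)
  also have "\<dots> = u [^] k \<oplus> (u [^] k \<otimes> inv u [^] k) \<otimes> (z \<ominus> u [^] k)"
    using u uU z by (simp add: r_distr m_assoc)
  also have "\<dots> = z"
    unfolding inv using u(1) z by (simp add: minus_eq a_ac r_neg)
  finally have "z = (u \<otimes> w) [^] k" ..
  moreover have "u \<otimes> w \<in> Units R" using uU w(1) by (rule Units_m_closed)
  ultimately show "z \<in> unit_powers R k" unfolding unit_powers_def by blast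
qed

lemma card_fibre:
  assumes x: "x \<in> carrier R"
  shows "card {y \<in> carrier R. \<forall>i \<in> I. f i y = f i x} = card (nilradical R)"
proof -
  interpret ideal "nilradical R" R by (rule nilradical_ideal)
  have "bij_betw ((\<oplus>) x) (nilradical R) {y \<in> carrier R. \<forall>i \<in> I. f i y = f i x}"
  proof (rule bij_betwI[of _ _ _ "\<lambda>y. y \<ominus> x"])
    show "(\<oplus>) x \<in> nilradical R \<rightarrow> {y \<in> carrier R. \<forall>i \<in> I. f i y = f i x}"
    proof
      fix n assume n: "n \<in> nilradical R"
      have "(x \<oplus> n) \<ominus> x = n" using x Icarr[OF n] by algebra
      then show "x \<oplus> n \<in> {y \<in> carrier R. \<forall>i \<in> I. f i y = f i x}"
        using n x Icarr[OF n] minus_in_nilradical_iff[of "x \<oplus> n" x] by simp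
    qed
    show "(\<lambda>y. y \<ominus> x) \<in> {y \<in> carrier R. \<forall>i \<in> I. f i y = f i x} \<rightarrow> nilradical R"
      using x by (auto simp: minus_in_nilradical_iff)
  next
    fix n assume "n \<in> nilradical R"
    then show "x \<oplus> n \<ominus> x = n" using x Icarr[of n] by algebra
  next
    fix y assume "y \<in> {y \<in> carrier R. \<forall>i \<in> I. f i y = f i x}"
    then show "x \<oplus> (y \<ominus> x) = y" using x by simp algebra
  qed
  then show ?thesis by (simp add: bij_betw_same_card)
qed

text \<open>
  The map \<open>F\<close> is any surjection that identifies the same elements as the family does; this leaves open
  how classes modulo \<open>N\<close> are represented, as cosets or as tuples of values.
\<close>

lemma unit_power_digraph_iso:
  assumes "k > 0" and "gcd k (card (carrier R)) = 1"
    and surj: "F ` carrier R = pverts H"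
    and eq: "\<And>x y. x \<in> carrier R \<Longrightarrow> y \<in> carrier R \<Longrightarrow> F x = F y \<longleftrightarrow> (\<forall>i \<in> I. f i x = f i y)"
    and "parcs H \<subseteq> pverts H \<times> pverts H"
    and arcs: "\<And>x y. x \<in> carrier R \<Longrightarrow> y \<in> carrier R \<Longrightarrow>
      (F x, F y) \<in> parcs H \<longleftrightarrow> (\<forall>i \<in> I. f i y \<ominus>\<^bsub>S i\<^esub> f i x \<in> unit_powers (S i) k)"
  shows "digraph_iso (with_proj (unit_power_digraph R k))
           (with_proj (kronecker H (looped_complete (card (nilradical R)))))"
proof (rule digraph_iso_kronecker_looped_complete)
  fix y assume "y \<in> pverts H"
  then obtain x where x: "x \<in> carrier R" "y = F x" using surj by auto
  have "{z \<in> pverts (unit_power_digraph R k). F z = y} = {z \<in> carrier R. \<forall>i \<in> I. f i z = f i x}"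
    using x eq by (auto simp: unit_power_digraph_def cayley_digraph_def)
  then show "card {z \<in> pverts (unit_power_digraph R k). F z = y} = card (nilradical R)"
    using card_fibre[OF x(1)] by simp
next
  fix x y assume "x \<in> pverts (unit_power_digraph R k)" "y \<in> pverts (unit_power_digraph R k)"
  then show "(x, y) \<in> parcs (unit_power_digraph R k) \<longleftrightarrow> (F x, F y) \<in> parcs H"
    using unit_powers_iff[OF assms(1,2), of "y \<ominus> x"] arcs
    by (simp add: unit_power_digraph_def cayley_digraph_def f_minus)
next
  show "finite (pverts (unit_power_digraph R k))"
    using finite_carrier by (simp add: unit_power_digraph_def cayley_digraph_def)
  show "F ` pverts (unit_power_digraph R k) = pverts H"
    using surj by (simp add: unit_power_digraph_def cayley_digraph_def)
  show "parcs (unit_power_digraph R k) \<subseteq> pverts (unit_power_digraph R k) \<times> pverts (unit_power_digraph R k)"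
    unfolding unit_power_digraph_def cayley_digraph_def by auto
qed (rule assms(5))

lemma unit_power_digraph_iso_kronecker_prod:
  assumes "k > 0" and "gcd k (card (carrier R)) = 1"
  shows "digraph_iso (with_proj (unit_power_digraph R k))
           (with_proj (kronecker (kronecker_prod I (\<lambda>i. unit_power_digraph (S i) k))
             (looped_complete (card (nilradical R)))))"
proof (rule unit_power_digraph_iso[where F = "\<lambda>x. \<lambda>i\<in>I. f i x"])
  let ?H = "kronecker_prod I (\<lambda>i. unit_power_digraph (S i) k)"
  have verts: "pverts ?H = (\<Pi>\<^sub>E i\<in>I. carrier (S i))"
    by (simp add: kronecker_prod_def unit_power_digraph_def cayley_digraph_def)
  have closed: "(\<lambda>i\<in>I. f i x) \<in> (\<Pi>\<^sub>E i\<in>I. carrier (S i))" if "x \<in> carrier R" for x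
    using that f_closed by auto
  show "(\<lambda>x. \<lambda>i\<in>I. f i x) ` carrier R = pverts ?H"
  proof (intro equalityI subsetI)
    fix y assume "y \<in> (\<lambda>x. \<lambda>i\<in>I. f i x) ` carrier R"
    then show "y \<in> pverts ?H" unfolding verts using closed by blast
  next
    fix y assume y: "y \<in> pverts ?H"
    then obtain x where x: "x \<in> carrier R" "\<forall>i \<in> I. f i x = y i"
      using jointly_surj[of y] unfolding verts by blast
    have "(\<lambda>i\<in>I. f i x) = y"
      using y x(2) unfolding verts by (intro PiE_ext[OF closed[OF x(1)]]) simp_all
    then show "y \<in> (\<lambda>x. \<lambda>i\<in>I. f i x) ` carrier R" using x(1) by blast
  qed
  show "(\<lambda>i\<in>I. f i x) = (\<lambda>i\<in>I. f i y) \<longleftrightarrow> (\<forall>i \<in> I. f i x = f i y)" for x y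
    by (auto simp: fun_eq_iff restrict_def)
  show "parcs ?H \<subseteq> pverts ?H \<times> pverts ?H"
    unfolding kronecker_prod_def by auto
  fix x y assume "x \<in> carrier R" "y \<in> carrier R"
  then show "((\<lambda>i\<in>I. f i x), (\<lambda>i\<in>I. f i y)) \<in> parcs ?H \<longleftrightarrow>
      (\<forall>i \<in> I. f i y \<ominus>\<^bsub>S i\<^esub> f i x \<in> unit_powers (S i) k)"
    using closed f_closed
    by (simp add: kronecker_prod_def unit_power_digraph_def cayley_digraph_def)
qed (use assms in simp_all)

end

section \<open>The reduced ring and the residue fields\<close>

lemma ideal_rcos_eq_zero_iff:
  assumes "ideal J R" and "x \<in> carrier R"
  shows "J +>\<^bsub>R\<^esub> x = \<zero>\<^bsub>R Quot J\<^esub> \<longleftrightarrow> x \<in> J"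
proof -
  interpret ideal J R by fact
  show ?thesis
    using assms(2) a_rcos_const a_rcos_self rcos_const_imp_mem by (auto simp: FactRing_def)
qed

lemma nilradical_kernel_family_reduced_ring:
  fixes R (structure)
  assumes "cring R" and "finite (carrier R)" and "ideal (nilradical R) R"
  shows "nilradical_kernel_family R {()} (\<lambda>_. reduced_ring R) (\<lambda>_. (+>\<^bsub>R\<^esub>) (nilradical R))"
proof -
  interpret cring R by fact
  interpret N: ideal "nilradical R" R by fact
  show ?thesis
  proof (intro nilradical_kernel_family.intro nilradical_kernel_family_axioms.intro)
    show "ring (reduced_ring R)"
      unfolding reduced_ring_def by (rule N.quotient_is_ring)
    show "(+>) (nilradical R) \<in> ring_hom R (reduced_ring R)"
      unfolding reduced_ring_def by (rule N.rcos_ring_hom)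
    show "\<exists>x \<in> carrier R. \<forall>i \<in> {()}. nilradical R +> x = y i"
      if "\<And>i. i \<in> {()} \<Longrightarrow> y i \<in> carrier (reduced_ring R)" for y
      using that[of "()"] by (auto simp: reduced_ring_def FactRing_def A_RCOSETS_def')
    show "{x \<in> carrier R. \<forall>i \<in> {()}. nilradical R +> x = \<zero>\<^bsub>reduced_ring R\<^esub>} = nilradical R"
      using ideal_rcos_eq_zero_iff[OF assms(3)] N.a_subset
      unfolding reduced_ring_def by auto
  qed (use assms(1,2) in auto)
qed

lemma (in domain) pow_eq_zero:
  assumes "x \<in> carrier R" and "x [^] (n::nat) = \<zero>"
  shows "x = \<zero>"
  using assms by (induction n) (auto simp: integral_iff)

text \<open>
  The maps are the projections \<open>p\<close> to the local factors followed by the residue maps \<open>r\<close>. An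
  element of the joint kernel has all its components in the maximal ideals, so they are nilpotent;
  the sum of their exponents annihilates all of them at once. Conversely, nilpotents vanish in fields.
\<close>

lemma nilradical_kernel_family_residue_fields:
  fixes R (structure) and Rs :: "('b, 'm) ring_scheme list" and F :: "nat \<Rightarrow> ('c, 'l) ring_scheme"
  assumes R: "cring R" and fin: "finite (carrier R)" and iso: "R \<simeq> RDirProd_list Rs"
    and loc: "\<And>i. i < length Rs \<Longrightarrow> local_ring (M i) (Rs ! i)"
    and field: "\<And>i. i < length Rs \<Longrightarrow> field (F i)"
    and residue: "\<And>i. i < length Rs \<Longrightarrow> (Rs ! i) Quot (M i) \<simeq> F i"
  obtains f where "nilradical_kernel_family R {..<length Rs} F f"
proof -
  interpret cring R by (rule R)
  let ?P = "RDirProd_list Rs"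
  have ringR: "ring (Rs ! i)" if "i < length Rs" for i
    using loc[OF that] by (simp add: local_ring_def cring_def)
  have ideal: "ideal (M i) (Rs ! i)" if "i < length Rs" for i
    using loc[OF that] by (simp add: local_ring_def maximalideal_def)
  have ringF: "ring (F i)" if "i < length Rs" for i
    using field[OF that] by (simp add: field_def domain_def cring_def)
  obtain h where h: "h \<in> ring_hom R ?P" and bij: "bij_betw h (carrier R) (carrier ?P)"
    using iso by (auto simp: is_ring_iso_def ring_iso_def)
  define p where "p i = (\<lambda>xs. xs ! i) \<circ> h" for i
  have p: "p i \<in> ring_hom R (Rs ! i)" if "i < length Rs" for i
    unfolding p_def using h nth_RDirProd_list_ring_hom[OF that] by (rule ring_hom_trans)
  have p_surj: "\<exists>x \<in> carrier R. \<forall>i < length Rs. p i x = y i"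
    if y: "\<And>i. i < length Rs \<Longrightarrow> y i \<in> carrier (Rs ! i)" for y
  proof -
    have "map y [0..<length Rs] \<in> carrier ?P"
      using y by (intro RDirProd_list_carrier_memI) auto
    then obtain x where "x \<in> carrier R" "h x = map y [0..<length Rs]"
      using bij by (metis bij_betw_imp_surj_on imageE)
    then show ?thesis by (intro bexI[of _ x]) (auto simp: p_def)
  qed
  have p_inj: "x = y" if "x \<in> carrier R" "y \<in> carrier R" "\<And>i. i < length Rs \<Longrightarrow> p i x = p i y" for x y
  proof -
    have "length (h z) = length Rs" if "z \<in> carrier R" for z
      using ring_hom_closed[OF h that] by (rule RDirProd_list_carrier_mem(1))
    then have "h x = h y"
      using that by (intro nth_equalityI) (auto simp: p_def)
    then show ?thesis using bij that by (auto simp: bij_betw_def inj_on_def)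
  qed
  have finR: "finite (carrier (Rs ! i))" if i: "i < length Rs" for i
  proof -
    have "carrier (Rs ! i) \<subseteq> p i ` carrier R"
    proof
      fix y assume "y \<in> carrier (Rs ! i)"
      \<comment> \<open>lift the tuple with \<open>y\<close> in position \<open>i\<close> and zeros elsewhere\<close>
      then have "\<exists>x \<in> carrier R. \<forall>j < length Rs. p j x = (if j = i then y else \<zero>\<^bsub>Rs ! j\<^esub>)"
        by (intro p_surj) (use ringR in \<open>auto intro: ring.ring_simprules(2)\<close>)
      then obtain x where "x \<in> carrier R" "p i x = y" using i by auto
      then show "y \<in> p i ` carrier R" by blast
    qed
    then show ?thesis using fin finite_surj by blast
  qed
  have "\<forall>i. \<exists>g. i < length Rs \<longrightarrow> g \<in> ring_hom ((Rs ! i) Quot (M i)) (F i) \<and>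
      bij_betw g (carrier ((Rs ! i) Quot (M i))) (carrier (F i))"
    using residue by (auto simp: is_ring_iso_def ring_iso_def)
  then obtain g where g: "\<And>i. i < length Rs \<Longrightarrow> g i \<in> ring_hom ((Rs ! i) Quot (M i)) (F i)"
    and g_bij: "\<And>i. i < length Rs \<Longrightarrow> bij_betw (g i) (carrier ((Rs ! i) Quot (M i))) (carrier (F i))"
    by metis
  define r where "r i = g i \<circ> (+>\<^bsub>Rs ! i\<^esub>) (M i)" for i
  have r: "r i \<in> ring_hom (Rs ! i) (F i)" if "i < length Rs" for i
    unfolding r_def using ideal.rcos_ring_hom[OF ideal[OF that]] g[OF that] by (rule ring_hom_trans)
  have r_surj: "r i ` carrier (Rs ! i) = carrier (F i)" if "i < length Rs" for i
    using g_bij[OF that]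
    by (auto simp: r_def bij_betw_def FactRing_def A_RCOSETS_def' image_image image_iff)
  have r_zero: "r i x = \<zero>\<^bsub>F i\<^esub> \<longleftrightarrow> x \<in> M i" if i: "i < length Rs" and x: "x \<in> carrier (Rs ! i)" for i x
  proof -
    let ?Q = "(Rs ! i) Quot (M i)"
    interpret Q: ring ?Q using ideal[OF i] by (rule ideal.quotient_is_ring)
    have "g i \<zero>\<^bsub>?Q\<^esub> = \<zero>\<^bsub>F i\<^esub>"
      using g[OF i] Q.ring_axioms ringF[OF i] by (rule ring_hom_zero)
    moreover have "M i +>\<^bsub>Rs ! i\<^esub> x \<in> carrier ?Q"
      using ideal.rcos_ring_hom[OF ideal[OF i]] x by (rule ring_hom_closed)
    ultimately have "r i x = \<zero>\<^bsub>F i\<^esub> \<longleftrightarrow> M i +>\<^bsub>Rs ! i\<^esub> x = \<zero>\<^bsub>?Q\<^esub>"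
      using g_bij[OF i] Q.zero_closed unfolding r_def bij_betw_def inj_on_def by (metis comp_apply)
    then show ?thesis using ideal_rcos_eq_zero_iff[OF ideal[OF i] x] by simp
  qed
  have rp: "r i \<circ> p i \<in> ring_hom R (F i)" if "i < length Rs" for i
    using p[OF that] r[OF that] by (rule ring_hom_trans)
  have "nilradical_kernel_family R {..<length Rs} F (\<lambda>i. r i \<circ> p i)"
  proof (intro nilradical_kernel_family.intro nilradical_kernel_family_axioms.intro)
    show "\<exists>x \<in> carrier R. \<forall>i \<in> {..<length Rs}. (r i \<circ> p i) x = y i"
      if y: "\<And>i. i \<in> {..<length Rs} \<Longrightarrow> y i \<in> carrier (F i)" for y
    proof -
      have "\<forall>i. \<exists>z. i < length Rs \<longrightarrow> z \<in> carrier (Rs ! i) \<and> r i z = y i"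
        using y r_surj by (metis imageE lessThan_iff)
      then obtain z where z: "\<And>i. i < length Rs \<Longrightarrow> z i \<in> carrier (Rs ! i) \<and> r i (z i) = y i"
        by metis
      then obtain x where "x \<in> carrier R" "\<forall>i < length Rs. p i x = z i" using p_surj[of z] by auto
      then show ?thesis using z by (intro bexI[of _ x]) auto
    qed
    show "{x \<in> carrier R. \<forall>i \<in> {..<length Rs}. (r i \<circ> p i) x = \<zero>\<^bsub>F i\<^esub>} = nilradical R"
    proof (intro equalityI subsetI)
      fix x assume "x \<in> nilradical R"
      then obtain n :: nat where x: "x \<in> carrier R" "x [^] n = \<zero>" by (auto simp: nilradical_def)
      have "(r i \<circ> p i) x = \<zero>\<^bsub>F i\<^esub>" if i: "i < length Rs" for i
      proof -
        have "(r i \<circ> p i) x [^]\<^bsub>F i\<^esub> n = (r i \<circ> p i) (x [^] n)"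
          using ring_hom_nat_pow[OF ring_axioms ringF[OF i] rp[OF i] x(1)] by simp
        also have "\<dots> = \<zero>\<^bsub>F i\<^esub>"
          unfolding x(2) using rp[OF i] ring_axioms ringF[OF i] by (rule ring_hom_zero)
        finally show ?thesis
          using domain.pow_eq_zero[OF field.axioms(1)[OF field[OF i]]] ring_hom_closed[OF rp[OF i] x(1)]
          by blast
      qed
      then show "x \<in> {x \<in> carrier R. \<forall>i \<in> {..<length Rs}. (r i \<circ> p i) x = \<zero>\<^bsub>F i\<^esub>}"
        using x(1) by simp
    next
      fix x assume "x \<in> {x \<in> carrier R. \<forall>i \<in> {..<length Rs}. (r i \<circ> p i) x = \<zero>\<^bsub>F i\<^esub>}"
      then have x: "x \<in> carrier R" and zero: "\<And>i. i < length Rs \<Longrightarrow> r i (p i x) = \<zero>\<^bsub>F i\<^esub>" by auto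
      have "\<exists>n::nat. p i x [^]\<^bsub>Rs ! i\<^esub> n = \<zero>\<^bsub>Rs ! i\<^esub>" if i: "i < length Rs" for i
        using local_ring.finite_maximalideal_nilpotent[OF loc[OF i] finR[OF i]]
          r_zero[OF i] zero[OF i] ring_hom_closed[OF p[OF i] x] by blast
      then obtain e :: "nat \<Rightarrow> nat"
        where e: "\<And>i. i < length Rs \<Longrightarrow> p i x [^]\<^bsub>Rs ! i\<^esub> e i = \<zero>\<^bsub>Rs ! i\<^esub>"
        by metis
      define n where "n = (\<Sum>i<length Rs. e i)"
      have "x [^] n = \<zero>"
      proof (rule p_inj)
        fix i assume i: "i < length Rs"
        interpret Ri: ring "Rs ! i" using i by (rule ringR)
        have px: "p i x \<in> carrier (Rs ! i)" using p[OF i] x by (rule ring_hom_closed)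
        have "e i \<le> n" unfolding n_def using i by (intro member_le_sum) auto
        then have "n = e i + (n - e i)" by simp
        then have "p i x [^]\<^bsub>Rs ! i\<^esub> n = p i x [^]\<^bsub>Rs ! i\<^esub> e i \<otimes>\<^bsub>Rs ! i\<^esub> p i x [^]\<^bsub>Rs ! i\<^esub> (n - e i)"
          using px Ri.nat_pow_mult by metis
        then have "p i x [^]\<^bsub>Rs ! i\<^esub> n = \<zero>\<^bsub>Rs ! i\<^esub>" using e[OF i] px by simp
        moreover have "p i (x [^] n) = p i x [^]\<^bsub>Rs ! i\<^esub> n"
          using ring_axioms Ri.ring_axioms p[OF i] x by (rule ring_hom_nat_pow)
        moreover have "p i \<zero> = \<zero>\<^bsub>Rs ! i\<^esub>"
          using p[OF i] ring_axioms Ri.ring_axioms by (rule ring_hom_zero)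
        ultimately show "p i (x [^] n) = p i \<zero>" by simp
      qed (use x in auto)
      then show "x \<in> nilradical R" using x by (auto simp: nilradical_def)
    qed
  qed (use R fin ringF rp in auto)
  then show thesis by (rule that)
qed

theorem theorem6p5:
  fixes R :: "('a, 'n) ring_scheme"
    and Rs :: "('b, 'm) ring_scheme list"
    and M :: "nat \<Rightarrow> 'b set"
    and F :: "nat \<Rightarrow> ('c, 'l) ring_scheme"
    and q :: "nat \<Rightarrow> nat"
    and k :: nat
  assumes "cring R" and "finite (carrier R)"
    and "Rs \<noteq> []" and "R \<simeq> RDirProd_list Rs"
    and "\<And>i. i < length Rs \<Longrightarrow> local_ring (M i) (Rs ! i)"
    and "\<And>i. i < length Rs \<Longrightarrow> field (F i) \<and> finite (carrier (F i)) \<and> card (carrier (F i)) = q i"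
    and "\<And>i. i < length Rs \<Longrightarrow> (Rs ! i) Quot (M i) \<simeq> F i"
    and "k > 0" and "gcd k (card (carrier R)) = 1"
  defines "m \<equiv> card (nilradical R)"
  shows "digraph_iso (with_proj (unit_power_digraph R k))
           (with_proj (kronecker
              (kronecker_prod {..<length Rs} (\<lambda>i. generalized_paley (F i) (gcd k (q i - 1))))
              (looped_complete m)))
       \<and> digraph_iso
           (with_proj (kronecker
              (kronecker_prod {..<length Rs} (\<lambda>i. generalized_paley (F i) (gcd k (q i - 1))))
              (looped_complete m)))
           (with_proj (kronecker (unit_power_digraph (reduced_ring R) k) (looped_complete m)))
       \<and> digraph_iso
           (with_proj (kronecker (unit_power_digraph (reduced_ring R) k) (looped_complete m)))
           (with_proj (balanced_blowup (unit_power_digraph (reduced_ring R) k) m))"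
proof -
  have field: "\<And>i. i < length Rs \<Longrightarrow> field (F i)" using assms(6) by blast
  obtain f where f: "nilradical_kernel_family R {..<length Rs} F f"
    using nilradical_kernel_family_residue_fields[OF assms(1,2,4,5) field assms(7)] by blast
  interpret res: nilradical_kernel_family R "{..<length Rs}" F f by (rule f)
  interpret red: nilradical_kernel_family R "{()}" "\<lambda>_. reduced_ring R" "\<lambda>_. (+>\<^bsub>R\<^esub>) (nilradical R)"
    using assms(1,2) res.nilradical_ideal by (rule nilradical_kernel_family_reduced_ring)
  let ?A = "unit_power_digraph R k"
  let ?B = "kronecker (kronecker_prod {..<length Rs} (\<lambda>i. generalized_paley (F i) (gcd k (q i - 1))))
              (looped_complete m)"
  let ?C = "kronecker (unit_power_digraph (reduced_ring R) k) (looped_complete m)"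
  have "kronecker_prod {..<length Rs} (\<lambda>i. generalized_paley (F i) (gcd k (q i - 1))) =
      kronecker_prod {..<length Rs} (\<lambda>i. unit_power_digraph (F i) k)"
  proof (rule kronecker_prod_cong)
    fix i assume "i \<in> {..<length Rs}"
    then show "generalized_paley (F i) (gcd k (q i - 1)) = unit_power_digraph (F i) k"
      using unit_powers_gcd_field[of "F i" k] assms(6)[of i] assms(8)
      by (auto simp: generalized_paley_def unit_power_digraph_def)
  qed
  then have AB: "digraph_iso (with_proj ?A) (with_proj ?B)"
    using res.unit_power_digraph_iso_kronecker_prod[OF assms(8,9)] by (simp add: m_def)
  have AC: "digraph_iso (with_proj ?A) (with_proj ?C)"
    unfolding m_def
  proof (rule red.unit_power_digraph_iso[OF assms(8,9), where F = "(+>\<^bsub>R\<^esub>) (nilradical R)"])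
    show "(+>\<^bsub>R\<^esub>) (nilradical R) ` carrier R = pverts (unit_power_digraph (reduced_ring R) k)"
      by (auto simp: unit_power_digraph_def cayley_digraph_def reduced_ring_def FactRing_def A_RCOSETS_def')
  next
    fix x y assume "x \<in> carrier R" "y \<in> carrier R"
    then show "(nilradical R +>\<^bsub>R\<^esub> x, nilradical R +>\<^bsub>R\<^esub> y) \<in> parcs (unit_power_digraph (reduced_ring R) k) \<longleftrightarrow>
        (\<forall>i \<in> {()}. (nilradical R +>\<^bsub>R\<^esub> y) \<ominus>\<^bsub>reduced_ring R\<^esub> (nilradical R +>\<^bsub>R\<^esub> x)
          \<in> unit_powers (reduced_ring R) k)"
      using red.f_closed by (simp add: unit_power_digraph_def cayley_digraph_def)
  qed (auto simp: unit_power_digraph_def cayley_digraph_def)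
  have wf: "wf_digraph (with_proj ?A)"
    by unfold_locales (auto simp: unit_power_digraph_def cayley_digraph_def)
  have "digraph_iso (with_proj ?B) (with_proj ?C)"
    using digraph_iso_swap[OF wf AB] AC by (rule digraph_iso_trans)
  moreover have "digraph_iso (with_proj ?C) (with_proj (balanced_blowup (unit_power_digraph (reduced_ring R) k) m))"
    unfolding balanced_blowup_eq_kronecker_looped_complete
    by (rule digraph_isoI[of id]) (auto simp: kronecker_def looped_complete_def unit_power_digraph_def cayley_digraph_def)
  ultimately show ?thesis using AB by blast
qed

end
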